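(* Let $\mathbf L=(L,\vee,\wedge,{}')$ be a lattice with a unary operation $'$ and let $\odot$ and $\to$ denote the Sasaki operations on $L$, i.e. $x\odot y:=(x\vee y')\wedge y$ and $x\to y:=x'\vee(x\wedge y)$ for all $x,y\in L$. Then the following holds: (i) If $\mathbf L$ satisfies the identity $y'\vee\big((x\vee y')\wedge y\big)\approx x\vee y'$, then for all $x,y,z\in L$: $x\odot y\le z$ implies $x\le y\to z$. (ii) If $\mathbf L$ satisfies the identity $\big(x'\vee(x\wedge y)\big)\wedge x\approx x\wedge y$, then for all $x,y,z\in L$: $x\le y\to z$ implies $x\odot y\le z$. (iii) If $\mathbf L$ satisfies both of the identities in (i) and (ii), then $\odot$ and $\to$ form an adjoint pair.
   Context: The unary operation $'$ is arbitrary (not assumed to be a complementation, an involution or antitone), and the lattice is not assumed bounded. The symbol $\approx$ denotes an identity, i.e. equality for all values of the variables. $\le$ is the lattice order. Two binary operations $\odot$ and $\to$ on a poset $(L,\le)$ form an adjoint pair if for all $x,y,z\in L$: $x\odot y\le z$ if and only if $x\le y\to z$. *)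

theory Defs
  imports Main
begin

unbundle lattice_syntax

text \<open>The unary operation of the lattice is passed as an arbitrary function \<open>c\<close>,
  with \<open>c x\<close> standing for \<open>x'\<close>; no property of it is assumed.\<close>

definition sasaki_prod :: "('a::lattice \<Rightarrow> 'a) \<Rightarrow> 'a \<Rightarrow> 'a \<Rightarrow> 'a" where
  "sasaki_prod c x y = (x \<squnion> c y) \<sqinter> y"

definition sasaki_imp :: "('a::lattice \<Rightarrow> 'a) \<Rightarrow> 'a \<Rightarrow> 'a \<Rightarrow> 'a" where
  "sasaki_imp c x y = c x \<squnion> (x \<sqinter> y)"

definition adjoint_pair :: "('a::order \<Rightarrow> 'a \<Rightarrow> 'a) \<Rightarrow> ('a \<Rightarrow> 'a \<Rightarrow> 'a) \<Rightarrow> bool" where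
  "adjoint_pair mult imp \<longleftrightarrow> (\<forall>x y z. mult x y \<le> z \<longleftrightarrow> x \<le> imp y z)"

end

theory Submission
  imports Defs
begin

text \<open>Fix \<open>y\<close>. The maps sending \<open>x\<close> to
  \<open>sasaki_prod c x y\<close> and \<open>z\<close> to \<open>sasaki_imp c y z\<close> are
  monotone, so adjointness reduces to a unit and a counit. Since \<open>sasaki_prod c x y\<close>
  \<le> \<open>y\<close>, the left side of the first identity is
  \<open>sasaki_imp c y (sasaki_prod c x y)\<close>, and its value \<open>x \<squnion> c y\<close>
  lies above \<open>x\<close>: the unit. The left side of the second, read at \<open>y\<close> and
  \<open>z\<close>, is \<open>sasaki_prod c (sasaki_imp c y z) y\<close>, and its value
  \<open>y \<sqinter> z\<close> lies below \<open>z\<close>: the counit.\<close>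

lemma le_sasaki_imp_if_sasaki_prod_le:
  fixes c :: "'a::lattice \<Rightarrow> 'a"
  assumes "c y \<squnion> ((x \<squnion> c y) \<sqinter> y) = x \<squnion> c y" and "sasaki_prod c x y \<le> z"
  shows "x \<le> sasaki_imp c y z"
proof -
  have "x \<le> c y \<squnion> ((x \<squnion> c y) \<sqinter> y)"
    by (simp add: assms(1))
  \<comment> \<open>The product lies below \<open>y\<close> because it is a meet with
    \<open>y\<close>, and below \<open>z\<close> by assumption.\<close>
  also have "\<dots> \<le> c y \<squnion> (y \<sqinter> z)"
    using assms(2) by (intro sup_mono le_infI order_refl inf_le2) (simp add: sasaki_prod_def)
  finally show ?thesis
    by (simp add: sasaki_imp_def)
qed

text \<open>Multiplying the assumed inequality by \<open>y\<close> on the right leads to the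
  counit.\<close>

lemma sasaki_prod_le_if_le_sasaki_imp:
  fixes c :: "'a::lattice \<Rightarrow> 'a"
  assumes "(c y \<squnion> (y \<sqinter> z)) \<sqinter> y = y \<sqinter> z" and "x \<le> sasaki_imp c y z"
  shows "sasaki_prod c x y \<le> z"
proof -
  \<comment> \<open>The implication bounds both \<open>x\<close>, by assumption, and
    \<open>c y\<close>, its own first joinand, so joining \<open>c y\<close> to \<open>x\<close>
    stays below it.\<close>
  have "(x \<squnion> c y) \<sqinter> y \<le> (c y \<squnion> (y \<sqinter> z)) \<sqinter> y"
    using assms(2) by (intro inf_mono le_supI order_refl sup_ge1) (simp add: sasaki_imp_def)
  also have "\<dots> \<le> z"
    by (simp add: assms(1))
  finally show ?thesis
    by (simp add: sasaki_prod_def)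
qed

theorem theorem2p2:
  fixes c :: "'a::lattice \<Rightarrow> 'a"
  shows
    "((\<forall>x y. c y \<squnion> ((x \<squnion> c y) \<sqinter> y) = x \<squnion> c y)
        \<longrightarrow> (\<forall>x y z. sasaki_prod c x y \<le> z \<longrightarrow> x \<le> sasaki_imp c y z))
     \<and> ((\<forall>x y. (c x \<squnion> (x \<sqinter> y)) \<sqinter> x = x \<sqinter> y)
        \<longrightarrow> (\<forall>x y z. x \<le> sasaki_imp c y z \<longrightarrow> sasaki_prod c x y \<le> z))
     \<and> ((\<forall>x y. c y \<squnion> ((x \<squnion> c y) \<sqinter> y) = x \<squnion> c y)
          \<and> (\<forall>x y. (c x \<squnion> (x \<sqinter> y)) \<sqinter> x = x \<sqinter> y)
        \<longrightarrow> adjoint_pair (sasaki_prod c) (sasaki_imp c))"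
  unfolding adjoint_pair_def
  by (blast intro: le_sasaki_imp_if_sasaki_prod_le sasaki_prod_le_if_le_sasaki_imp)

end
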